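(* For every $k\in\mathbb{N}$ and every $n\ge 2$, there exist a bounded domain $D\subset\mathbb{C}^n$ and a holomorphic map $f:D\to D$ such that $\#(\mathrm{Fix}(f))=k$, i.e. $f$ has exactly $k$ fixed points in $D$.
   Context: $\mathrm{Fix}(f)=\{x\in D : f(x)=x\}$ denotes the fixed point set of $f$, and $\#$ denotes cardinality. A domain is a connected nonempty open set. *)

theory Defs
  imports "HOL-Analysis.Analysis"
begin

definition domain :: "'a::topological_space set \<Rightarrow> bool" where
  "domain D \<longleftrightarrow> open D \<and> connected D \<and> D \<noteq> {}"

text \<open>
  Holomorphy in several complex variables is complex Frechet differentiability: the library's
  (real) Frechet derivative exists at every point and is complex linear. Additivity is already
  part of \<open>has_derivative\<close>, so only compatibility with the complex scalar multiplication
  \<open>*s\<close> is added. As in \<open>holomorphic_on\<close>, the derivative is taken within the set; for open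
  sets this is the derivative at the point.
\<close>
definition holomorphic_map_on ::
    "(complex ^ 'n::finite \<Rightarrow> complex ^ 'm::finite) \<Rightarrow> (complex ^ 'n) set \<Rightarrow> bool" where
  "holomorphic_map_on f D \<longleftrightarrow>
     (\<forall>z\<in>D. \<exists>f'. (f has_derivative f') (at z within D) \<and> (\<forall>c h. f' (c *s h) = c *s f' h))"

definition Fix :: "'a set \<Rightarrow> ('a \<Rightarrow> 'a) \<Rightarrow> 'a set" where
  "Fix D f = {x \<in> D. f x = x}"

end

theory Submission imports Defs
begin

text \<open>
  For \<open>k = 0\<close> take the antipodal map of the punctured ball. For \<open>k > 0\<close> the hyperelliptic curve
  \<open>x\<^sup>k - y\<^sup>2 = 1\<close> carries the involution \<open>(x, y) \<mapsto> (x, -y)\<close>, whose fixed points are the \<open>k\<close> points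
  \<open>(\<omega>, 0)\<close> with \<open>\<omega>\<^sup>k = 1\<close>. Since \<open>W = x\<^sup>k - y\<^sup>2\<close> is weighted homogeneous,
  \<open>(x, y) \<mapsto> (W powr (-1/k) x, W powr (-1/2) y)\<close> is a holomorphic retraction of \<open>Re W > 0\<close> onto
  the curve. Its composite with the involution (and with the projection to the first two
  coordinates) has precisely those \<open>k\<close> fixed points, and they lie in a single component of a
  suitable bounded invariant open set.
\<close>

section \<open>Complex differentiation of scalar functions and of maps built from
  coordinates\<close>

definition holomorphic_at :: "(complex ^ 'n::finite \<Rightarrow> complex) \<Rightarrow> complex ^ 'n \<Rightarrow> bool" where
  "holomorphic_at g z \<longleftrightarrow>
     (\<exists>g'. (g has_derivative g') (at z) \<and> (\<forall>c h. g' (c *s h) = c * g' h))"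

lemma holomorphic_at_nth: "holomorphic_at (\<lambda>z. z $ i) z"
  unfolding holomorphic_at_def
  by (intro exI[of _ "\<lambda>h. h $ i"]) (auto intro!: bounded_linear_imp_has_derivative bounded_linear_vec_nth)

lemma holomorphic_at_diff:
  assumes "holomorphic_at f z" "holomorphic_at g z"
  shows "holomorphic_at (\<lambda>z. f z - g z) z"
proof -
  from assms obtain f' g' where
    "(f has_derivative f') (at z)" "\<forall>c h. f' (c *s h) = c * f' h"
    "(g has_derivative g') (at z)" "\<forall>c h. g' (c *s h) = c * g' h"
    unfolding holomorphic_at_def by blast
  then show ?thesis unfolding holomorphic_at_def
    by (intro exI[of _ "\<lambda>h. f' h - g' h"]) (auto intro!: has_derivative_diff simp: algebra_simps)
qed

lemma holomorphic_at_mult: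
  assumes "holomorphic_at f z" "holomorphic_at g z"
  shows "holomorphic_at (\<lambda>z. f z * g z) z"
proof -
  from assms obtain f' g' where
    "(f has_derivative f') (at z)" "\<forall>c h. f' (c *s h) = c * f' h"
    "(g has_derivative g') (at z)" "\<forall>c h. g' (c *s h) = c * g' h"
    unfolding holomorphic_at_def by blast
  then show ?thesis unfolding holomorphic_at_def
    by (intro exI[of _ "\<lambda>h. f z * g' h + f' h * g z"])
      (auto intro!: has_derivative_mult simp: algebra_simps)
qed

text \<open>The outer derivative is multiplication by \<open>d\<close>, which keeps the derivative
  of the composite complex linear.\<close>

lemma holomorphic_at_compose:
  assumes "holomorphic_at g z" "(\<phi> has_field_derivative d) (at (g z))"
  shows "holomorphic_at (\<lambda>z. \<phi> (g z)) z"
proof -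
  from assms(1) obtain g' where
    g: "(g has_derivative g') (at z)" "\<forall>c h. g' (c *s h) = c * g' h"
    unfolding holomorphic_at_def by blast
  have "((\<lambda>z. \<phi> (g z)) has_derivative (\<lambda>h. d * g' h)) (at z)"
    using has_derivative_compose[OF g(1) assms(2)[unfolded has_field_derivative_def]] .
  with g(2) show ?thesis unfolding holomorphic_at_def
    by (intro exI[of _ "\<lambda>h. d * g' h"]) (auto simp: algebra_simps)
qed

lemma norm_axis: "norm (axis i x :: 'a::real_normed_vector ^ 'n::finite) = norm x"
proof -
  have "(norm (axis i x $ l))\<^sup>2 = (if l = i then (norm x)\<^sup>2 else 0)" for l :: 'n
    by (simp add: axis_def)
  then show ?thesis by (simp add: norm_vec_def L2_set_def)
qed

lemma bounded_linear_axis: "bounded_linear (axis i :: complex \<Rightarrow> complex ^ 'n::finite)"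
  by (rule bounded_linear_intro[where K = 1])
    (simp_all add: norm_axis, simp_all add: vec_eq_iff axis_def)

text \<open>\<open>axis\<close> is bounded linear and commutes with complex scalars, so derivatives
  can be placed coordinatewise. The sum of two axes is the shape of
  \<open>twisted_retraction\<close>.\<close>

lemma holomorphic_map_on_axis_add:
  fixes D :: "(complex ^ 'n::finite) set" and i j :: "'m::finite"
  assumes "\<And>z. z \<in> D \<Longrightarrow> holomorphic_at f z" "\<And>z. z \<in> D \<Longrightarrow> holomorphic_at g z"
  shows "holomorphic_map_on (\<lambda>z. axis i (f z) + axis j (g z)) D"
  unfolding holomorphic_map_on_def
proof
  fix z assume "z \<in> D"
  with assms obtain f' g' where
    fg: "(f has_derivative f') (at z)" "\<forall>c h. f' (c *s h) = c * f' h"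
    "(g has_derivative g') (at z)" "\<forall>c h. g' (c *s h) = c * g' h"
    unfolding holomorphic_at_def by meson
  have "((\<lambda>z. axis i (f z) + axis j (g z)) has_derivative
      (\<lambda>h. axis i (f' h) + axis j (g' h))) (at z within D)"
    by (intro has_derivative_add bounded_linear.has_derivative[OF bounded_linear_axis]
        has_derivative_at_withinI[OF fg(1)] has_derivative_at_withinI[OF fg(3)])
  moreover have "\<forall>c h. axis i (f' (c *s h)) + axis j (g' (c *s h)) =
      c *s (axis i (f' h) + axis j (g' h))"
    using fg by (auto simp: vec_eq_iff axis_def algebra_simps)
  ultimately show "\<exists>f'. ((\<lambda>z. axis i (f z) + axis j (g z)) has_derivative f') (at z within D)
      \<and> (\<forall>c h. f' (c *s h) = c *s f' h)" by blast
qed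

lemma holomorphic_map_on_imp_continuous_on:
  "holomorphic_map_on f D \<Longrightarrow> continuous_on D f"
  unfolding holomorphic_map_on_def continuous_on_eq_continuous_within
  by (meson has_derivative_continuous)

lemma holomorphic_map_on_subset:
  "holomorphic_map_on f D \<Longrightarrow> E \<subseteq> D \<Longrightarrow> holomorphic_map_on f E"
  unfolding holomorphic_map_on_def by (meson has_derivative_subset subsetD)

section \<open>The twisted retraction and its fixed points\<close>

definition weight :: "nat \<Rightarrow> 'n \<Rightarrow> 'n \<Rightarrow> complex ^ 'n::finite \<Rightarrow> complex" where
  "weight k i j z = z $ i ^ k - z $ j ^ 2"

definition twisted_retraction :: "nat \<Rightarrow> 'n \<Rightarrow> 'n \<Rightarrow> complex ^ 'n::finite \<Rightarrow> complex ^ 'n" where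
  "twisted_retraction k i j z =
     axis i (z $ i * weight k i j z powr (- 1 / of_nat k)) +
     axis j (- (z $ j * weight k i j z powr (- 1 / 2)))"

text \<open>Negative powers of the weight can enlarge the norm, hence a separate bound on the image.
  Any radius above 2 would serve: points of the curve with both coordinates in the closed unit disc
  have norm at most 2.\<close>

definition invariant_set :: "nat \<Rightarrow> 'n \<Rightarrow> 'n \<Rightarrow> (complex ^ 'n::finite) set" where
  "invariant_set k i j =
     {z. 0 < Re (weight k i j z) \<and> norm z < 3 \<and> norm (twisted_retraction k i j z) < 3}"

context
  fixes k :: nat and i j :: "'n::finite"
  assumes k: "k > 0" and ij: "i \<noteq> j"
begin

lemma holomorphic_at_weight: "holomorphic_at (weight k i j) z"
proof -
  have "holomorphic_at (\<lambda>z. z $ l ^ m) z" for l :: 'n and m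
    by (rule holomorphic_at_compose[OF holomorphic_at_nth]) (auto intro!: derivative_eq_intros)
  then show ?thesis unfolding weight_def by (intro holomorphic_at_diff)
qed

text \<open>A positive real part keeps the weight off the branch cut of the principal power.\<close>

lemma holomorphic_at_weight_powr:
  assumes "0 < Re (weight k i j z)"
  shows "holomorphic_at (\<lambda>z. weight k i j z powr a) z"
proof (rule holomorphic_at_compose[OF holomorphic_at_weight])
  have "weight k i j z \<notin> \<real>\<^sub>\<le>\<^sub>0"
    using assms by (auto simp: complex_nonpos_Reals_iff)
  then show "((\<lambda>w. w powr a) has_field_derivative a * weight k i j z powr (a - 1)) (at (weight k i j z))"
    by (rule has_field_derivative_powr)
qed

lemma holomorphic_twisted_retraction:
  "holomorphic_map_on (twisted_retraction k i j) {z. 0 < Re (weight k i j z)}"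
proof -
  have "holomorphic_at (\<lambda>z. - (z $ j * weight k i j z powr (- 1 / 2))) z"
    if "0 < Re (weight k i j z)" for z
    by (rule holomorphic_at_compose[where \<phi> = uminus and d = "-1",
          OF holomorphic_at_mult[OF holomorphic_at_nth holomorphic_at_weight_powr[OF that]]])
      (auto intro!: derivative_eq_intros)
  then show ?thesis
    unfolding twisted_retraction_def
    by (intro holomorphic_map_on_axis_add)
      (auto intro!: holomorphic_at_mult holomorphic_at_nth holomorphic_at_weight_powr)
qed

lemma twisted_retraction_nth:
  "twisted_retraction k i j z $ l =
     (if l = i then z $ i * weight k i j z powr (- 1 / of_nat k)
      else if l = j then - (z $ j * weight k i j z powr (- 1 / 2)) else 0)"
  using ij by (auto simp: twisted_retraction_def axis_def)

text \<open>Both the \<open>k\<close>-th power of \<open>z $ i\<close> and the square of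
  \<open>z $ j\<close> get multiplied by the inverse of the weight; the sign in coordinate
  \<open>j\<close> disappears on squaring.\<close>

lemma weight_twisted_retraction:
  assumes "weight k i j z \<noteq> 0"
  shows "weight k i j (twisted_retraction k i j z) = 1"
proof -
  let ?w = "weight k i j z"
  have root: "(?w powr (- 1 / of_nat m)) ^ m = inverse ?w" if "m > 0" for m
  proof -
    \<comment> \<open>Written as an exponential of \<open>Ln ?w\<close>, the root identity holds for
      every nonzero weight, whatever the branch.\<close>
    have "(?w powr (- 1 / of_nat m)) ^ m = exp (of_nat m * (- 1 / of_nat m * Ln ?w))"
      using assms by (simp only: powr_def exp_of_nat_mult if_False)
    also have "of_nat m * (- 1 / of_nat m * Ln ?w) = - Ln ?w" using that by simp
    finally show ?thesis using assms by (simp add: exp_minus)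
  qed
  note 1 = root[OF k] and 2 = root[of 2]
  have "weight k i j (twisted_retraction k i j z) = (z $ i ^ k - z $ j ^ 2) * inverse ?w"
    unfolding weight_def[of k i j "twisted_retraction k i j z"] twisted_retraction_nth
    using ij 1 2 by (simp add: power_mult_distrib left_diff_distrib)
  then show ?thesis using assms by (simp add: weight_def)
qed

lemma twisted_retraction_on_curve:
  assumes "weight k i j z = 1"
  shows "twisted_retraction k i j z = axis i (z $ i) + axis j (- z $ j)"
  using assms by (simp add: twisted_retraction_def)

lemma norm_axis_add_minus: "norm (axis i a + axis j (- b) :: complex ^ 'n) = norm (axis i a + axis j b)"
  using ij unfolding norm_vec_def by (intro arg_cong2[where f = L2_set]) (auto simp: axis_def)

text \<open>The image lies on the curve, where a second application only flips the sign of
  coordinate \<open>j\<close>. The second image thus has the norm of the first, which is below 3 by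
  assumption.\<close>

lemma twisted_retraction_in_invariant_set:
  assumes "z \<in> invariant_set k i j"
  shows "twisted_retraction k i j z \<in> invariant_set k i j"
proof -
  let ?f = "twisted_retraction k i j"
  have w: "weight k i j (?f z) = 1"
    using assms by (intro weight_twisted_retraction) (auto simp: invariant_set_def)
  have "norm (?f (?f z)) = norm (axis i (?f z $ i) + axis j (?f z $ j))"
    by (simp only: twisted_retraction_on_curve[OF w] norm_axis_add_minus)
  also have "axis i (?f z $ i) + axis j (?f z $ j) = ?f z"
    using ij by (auto simp: vec_eq_iff axis_def twisted_retraction_nth)
  finally show ?thesis using assms w by (auto simp: invariant_set_def)
qed

lemma on_curve_in_invariant_set:
  assumes "a ^ k - b ^ 2 = 1" "norm a \<le> 1" "norm b \<le> 1"
  shows "axis i a + axis j b \<in> invariant_set k i j"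
proof -
  let ?z = "axis i a + axis j b :: complex ^ 'n"
  have z: "?z $ i = a" "?z $ j = b" using ij by (auto simp: axis_def)
  have w: "weight k i j ?z = 1" using assms by (simp only: weight_def z)
  have "norm ?z \<le> norm a + norm b"
    by (metis norm_triangle_ineq norm_axis)
  then have "norm ?z < 3" using assms by simp
  then show ?thesis
    using w twisted_retraction_on_curve[OF w, unfolded z]
    by (simp add: invariant_set_def norm_axis_add_minus)
qed

text \<open>A fixed point is its own image, so it lies on the curve. There the map negates
  coordinate \<open>j\<close> and clears all coordinates other than \<open>i\<close> and
  \<open>j\<close>, which leaves only \<open>axis i \<omega>\<close> with
  \<open>\<omega> ^ k = 1\<close>.\<close>

lemma Fix_twisted_retraction:
  "Fix (invariant_set k i j) (twisted_retraction k i j) = axis i ` {\<omega>. \<omega> ^ k = 1}"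
proof (intro equalityI subsetI)
  fix z assume "z \<in> Fix (invariant_set k i j) (twisted_retraction k i j)"
  then have z: "0 < Re (weight k i j z)" "twisted_retraction k i j z = z"
    by (auto simp: Fix_def invariant_set_def)
  then have w: "weight k i j z = 1" using weight_twisted_retraction[of z] by fastforce
  have eq: "z = axis i (z $ i) + axis j (- z $ j)"
    using z twisted_retraction_on_curve[OF w] by simp
  then have "z $ j = (axis i (z $ i) + axis j (- z $ j)) $ j" by simp
  then have y: "z $ j = 0" using ij by (simp add: axis_def)
  moreover have "z $ i ^ k = 1" using w y by (simp add: weight_def)
  moreover have "z = axis i (z $ i)"
    using eq y by (metis add.right_neutral axis_eq_0_iff minus_zero)
  ultimately show "z \<in> axis i ` {\<omega>. \<omega> ^ k = 1}" by blast
next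
  fix z :: "complex ^ 'n" assume "z \<in> axis i ` {\<omega>. \<omega> ^ k = 1}"
  then obtain \<omega> where \<omega>: "\<omega> ^ k = 1" "z = axis i \<omega> + axis j 0" by auto
  have "norm \<omega> = 1" using \<omega>(1) k
    by (metis power_eq_1_iff less_irrefl)
  then have "z \<in> invariant_set k i j" using on_curve_in_invariant_set[of \<omega> 0] \<omega> by simp
  moreover have "weight k i j z = 1" using \<omega> ij by (simp add: weight_def axis_def)
  then have "twisted_retraction k i j z = axis i (z $ i) + axis j (- z $ j)"
    by (rule twisted_retraction_on_curve)
  then have "twisted_retraction k i j z = z" using \<omega> ij by (simp add: axis_def)
  ultimately show "z \<in> Fix (invariant_set k i j) (twisted_retraction k i j)"
    by (simp add: Fix_def)
qed

section \<open>Topology of the invariant set\<close>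

lemma open_invariant_set: "open (invariant_set k i j)"
proof -
  let ?V = "{z. 0 < Re (weight k i j z)}"
  have V: "open ?V" unfolding weight_def by (intro open_Collect_less continuous_intros)
  \<comment> \<open>Continuity is available on the open set \<open>?V\<close>, so the bound on the
    image is pulled back relative to \<open>?V\<close>.\<close>
  have "continuous_on ?V (\<lambda>z. norm (twisted_retraction k i j z))"
    by (intro continuous_on_norm holomorphic_map_on_imp_continuous_on holomorphic_twisted_retraction)
  then have "open ((\<lambda>z. norm (twisted_retraction k i j z)) -` {..<3} \<inter> ?V)"
    using continuous_on_open_vimage[OF V] open_lessThan by blast
  then have "open (((\<lambda>z. norm (twisted_retraction k i j z)) -` {..<3} \<inter> ?V) \<inter> ball 0 3)"
    by (rule open_Int[OF _ open_ball])
  also have "((\<lambda>z. norm (twisted_retraction k i j z)) -` {..<3} \<inter> ?V) \<inter> ball 0 3 = invariant_set k i j"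
    by (auto simp: invariant_set_def)
  finally show ?thesis .
qed

text \<open>The arcs \<open>t \<mapsto> (\<omega> (1 - t\<^sup>2)\<^bsup>1/k\<^esup>, \<i> t)\<close> on the curve all meet in \<open>(0, \<i>)\<close>.\<close>
lemma connected_component_roots_of_unity:
  assumes "\<omega> ^ k = 1"
  shows "connected_component (invariant_set k i j) (axis j \<i>) (axis i \<omega>)"
proof -
  define \<gamma> where "\<gamma> t = axis i (\<omega> * of_real (root k (1 - t\<^sup>2))) + axis j (\<i> * of_real t)" for t :: real
  have "continuous_on {0..1} \<gamma>"
    unfolding \<gamma>_def
    by (intro continuous_on_add bounded_linear.continuous_on[OF bounded_linear_axis] continuous_intros)
  then have "connected (\<gamma> ` {0..1})" by (intro connected_continuous_image) auto
  moreover have "\<gamma> ` {0..1} \<subseteq> invariant_set k i j"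
  proof clarify
    fix t :: real assume t: "t \<in> {0..1}"
    have t2: "0 \<le> 1 - t\<^sup>2" "1 - t\<^sup>2 \<le> 1" using t by (auto simp: power_le_one)
    have "norm \<omega> = 1" using assms k
      by (metis power_eq_1_iff less_irrefl)
    moreover have "\<bar>root k (1 - t\<^sup>2)\<bar> \<le> 1" using t2 k by simp
    \<comment> \<open>The square of \<open>\<i> * of_real t\<close> is \<open>- t\<^sup>2\<close>,
      which compensates the loss in the \<open>k\<close>-th power.\<close>
    moreover have "(\<omega> * of_real (root k (1 - t\<^sup>2))) ^ k - (\<i> * of_real t)\<^sup>2 = 1"
    proof -
      have "(\<omega> * of_real (root k (1 - t\<^sup>2))) ^ k = of_real (root k (1 - t\<^sup>2) ^ k)"
        using assms by (simp add: power_mult_distrib)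
      also have "root k (1 - t\<^sup>2) ^ k = 1 - t\<^sup>2" using t2 k by simp
      finally show ?thesis by (simp add: power_mult_distrib)
    qed
    ultimately show "\<gamma> t \<in> invariant_set k i j" unfolding \<gamma>_def
      using t by (intro on_curve_in_invariant_set) (auto simp: norm_mult)
  qed
  moreover have "\<gamma> 1 = axis j \<i>" "\<gamma> 0 = axis i \<omega>" using k by (auto simp: \<gamma>_def)
  then have "axis j \<i> \<in> \<gamma> ` {0..1}" "axis i \<omega> \<in> \<gamma> ` {0..1}"
    by (metis atLeastAtMost_iff imageI order_refl zero_le_one)+
  ultimately show ?thesis unfolding connected_component_def by blast
qed

lemma exists_domain_positive_fixed_points:
  "\<exists>(D :: (complex ^ 'n) set) f.
     domain D \<and> bounded D \<and> holomorphic_map_on f D \<and> f ` D \<subseteq> D \<and>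
     finite (Fix D f) \<and> card (Fix D f) = k"
proof (intro exI conjI)
  let ?U = "invariant_set k i j" and ?f = "twisted_retraction k i j"
  \<comment> \<open>The base point is the common endpoint of the arcs, so this single component
    contains all the fixed points.\<close>
  define D where "D = connected_component_set ?U (axis j \<i>)"
  have roots: "axis i \<omega> \<in> D" if "\<omega> ^ k = 1" for \<omega>
    using connected_component_roots_of_unity[OF that] by (simp add: D_def)
  have DU: "D \<subseteq> ?U" unfolding D_def by (rule connected_component_subset)
  have F: "Fix D ?f = axis i ` {\<omega>. \<omega> ^ k = 1}"
    using Fix_twisted_retraction roots DU by (auto simp: Fix_def)
  show "domain D"
    using roots[of 1] open_invariant_set unfolding domain_def D_def
    by (auto intro: open_connected_component)
  show "bounded D"
    by (rule bounded_subset[OF bounded_ball[of 0 3]]) (use DU in \<open>auto simp: invariant_set_def\<close>)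
  show hol: "holomorphic_map_on ?f D"
    by (rule holomorphic_map_on_subset[OF holomorphic_twisted_retraction])
      (use DU in \<open>auto simp: invariant_set_def\<close>)
  have "connected (?f ` D)"
    by (intro connected_continuous_image holomorphic_map_on_imp_continuous_on hol)
      (simp add: D_def)
  \<comment> \<open>This fixed point lies both in \<open>D\<close> and in its image. The image,
    being connected and inside \<open>?U\<close>, therefore cannot leave the component.\<close>
  moreover have "axis i 1 \<in> Fix D ?f" using F by auto
  then have "axis i 1 \<in> ?f ` D" unfolding Fix_def by (auto intro!: image_eqI)
  moreover have "?f ` D \<subseteq> ?U" using DU twisted_retraction_in_invariant_set by auto
  ultimately have "?f ` D \<subseteq> connected_component_set ?U (axis i 1)"
    by (intro connected_component_maximal)
  also have "\<dots> = D"
    using connected_component_eq roots[of 1] unfolding D_def by fastforce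
  finally show "?f ` D \<subseteq> D" .
  show "finite (Fix D ?f)" unfolding F using k by (intro finite_imageI finite_roots_unity) auto
  have "inj (axis i :: complex \<Rightarrow> complex ^ 'n)" by (auto simp: inj_def axis_eq_axis)
  then show "card (Fix D ?f) = k"
    unfolding F using card_roots_unity_eq[OF k] by (subst card_image) (auto intro: inj_on_subset)
qed

end

theorem proposition1p3:
  fixes k :: nat
  assumes "CARD('n::finite) \<ge> 2"
  shows "\<exists>(D :: (complex ^ 'n) set) (f :: complex ^ 'n \<Rightarrow> complex ^ 'n).
           domain D \<and> bounded D \<and> holomorphic_map_on f D \<and> f ` D \<subseteq> D \<and>
           finite (Fix D f) \<and> card (Fix D f) = k"
proof (cases "k = 0")
  case True
  \<comment> \<open>Negation fixes only the origin, so the origin is removed; the ball stays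
    connected because its real dimension is at least 2.\<close>
  let ?D = "ball 0 1 - {0} :: (complex ^ 'n) set"
  have "domain ?D" unfolding domain_def
  proof (intro conjI)
    show "open ?D" by auto
    show "connected ?D" using assms by (intro connected_punctured_ball) auto
    have "axis undefined (1 / 2) \<in> ?D" by (auto simp: norm_axis axis_eq_0_iff)
    then show "?D \<noteq> {}" by blast
  qed
  moreover have "bounded ?D" by (intro bounded_diff bounded_ball)
  moreover have "holomorphic_map_on uminus ?D"
    unfolding holomorphic_map_on_def
    by (auto intro!: exI[of _ uminus] has_derivative_minus has_derivative_ident simp: vec_eq_iff)
  moreover have "uminus ` ?D \<subseteq> ?D" by auto
  moreover have "Fix ?D uminus = {}"
    by (auto simp: Fix_def vec_eq_iff)
  ultimately show ?thesis using True by (intro exI[of _ ?D] exI[of _ uminus]) simp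
next
  case False
  \<comment> \<open>Two distinct coordinates are needed to carry the plane curve.\<close>
  obtain i j :: 'n where "i \<noteq> j"
    using assms by (metis One_nat_def Suc_1 card_le_Suc0_iff_eq finite not_less_eq_eq UNIV_I)
  with False show ?thesis by (intro exists_domain_positive_fixed_points) auto
qed

end
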